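(* If all clients and facilities are located on a line (with $n$ clients, of which $k$ are strategic), the strong price of anarchy and the strong price of stability of Mechanism $GM^*$ are at most \[ \begin{cases}\frac{n+k}{n-k} & \text{if } k\le \frac n2,\\[2pt] 3 & \text{if } k>\frac n2,\end{cases} \] and these bounds are asymptotically tight.
   Context: Setting (line metric). The metric space is a line with the usual distance $d$. An instance consists of a set $\mathcal{C}$ of $n$ clients, each having a true location on the line (several clients may share a location; the true location of client $i$ is also denoted $i$); a finite set $\mathcal{F}$ of possible facility locations on the line, ordered from left to right (the leftmost is the lowest-numbered); and a partition $\mathcal{C}=T\cup L$, $T\cap L=\emptyset$, with $|L|=k$, $|T|=n-k$. Clients in $T$ always report their true location; each client $i\in L$ (strategic) may report any point $x_i$ of the line. Let $\vec t$ be the vector of true locations of clients in $T$ and $\vec x=(x_i)_{i\in L}$ the vector of reports of the strategic clients. Perceived cost of $A\in\mathcal{F}$: $cost_A(\vec t;\vec x)=\sum_{i\in T}d(i,A)+\sum_{i\in L}d(x_i,A)$. Mechanism $GM^*$: given reports $(\vec t;\vec x)$, output the facility $GM^*(\vec t;\vec x)\in\mathcal{F}$ minimizing $cost_A(\vec t;\vec x)$ over $A\in\mathcal{F}$, ties broken in favor of the lowest-numbered facility. Strong Nash equilibrium (SNE) under a mechanism $M$: a profile $(\vec t;\vec x)$ such that for every nonempty set of clients $I\subseteq L$ and every vector $x_I'$ of locations that the clients in $I$ can report, there is a client $i\in I$ with $d(i,M(\vec t;\vec x_{-I},x_I'))\ge d(i,M(\vec t;\vec x))$, where $(\vec x_{-I},x_I')$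 is $\vec x$ with the reports of clients in $I$ replaced by $x_I'$. Let $O\in\mathcal{F}$ be the optimal solution, i.e. a facility location minimizing the true cost $\sum_{i\in\mathcal{C}}d(i,O)$, and let $S$ be the set of facilities $A$ such that some SNE under the mechanism selects $A$. The strong price of stability (resp. strong price of anarchy) of an instance is the infimum (resp. supremum) over $A\in S$ of $\frac{\sum_{i\in\mathcal{C}}d(i,A)}{\sum_{i\in\mathcal{C}}d(i,O)}$; the strong price of stability (resp. anarchy) of a mechanism is the worst case of this quantity over all instances. *)

theory Defs
  imports Complex_Main "HOL-Library.Extended_Real"
begin

text \<open>
  A facility is identified with its position in \<open>\<real>\<close>, so the left-to-right numbering of the
  facilities is the order of \<open>\<real>\<close>. Clients are labelled by arbitrary natural numbers; the
  partition of the client set into truthful and strategic clients is given by its two parts.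
\<close>

record line_instance =
  truthful :: "nat set"
  strategic :: "nat set"
  loc :: "nat \<Rightarrow> real"
  facilities :: "real set"

definition clients :: "line_instance \<Rightarrow> nat set" where
  "clients I = truthful I \<union> strategic I"

definition line_instances :: "nat \<Rightarrow> nat \<Rightarrow> line_instance set" where
  "line_instances n k = {I.
     finite (truthful I) \<and> finite (strategic I) \<and> truthful I \<inter> strategic I = {} \<and>
     card (clients I) = n \<and> card (strategic I) = k \<and>
     finite (facilities I) \<and> facilities I \<noteq> {}}"

text \<open>
  A mechanism sees the sets of truthful and strategic clients, the facilities and the joint
  report vector \<open>(t; x)\<close> (one function on all clients), but not the true locations of the
  strategic clients.
\<close>

type_synonym mechanism = "nat set \<Rightarrow> nat set \<Rightarrow> real set \<Rightarrow> (nat \<Rightarrow> real) \<Rightarrow> real"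

definition perceived_cost :: "nat set \<Rightarrow> nat set \<Rightarrow> (nat \<Rightarrow> real) \<Rightarrow> real \<Rightarrow> real" where
  "perceived_cost T L r A = (\<Sum>i\<in>T. dist (r i) A) + (\<Sum>i\<in>L. dist (r i) A)"

definition GM_star :: mechanism where
  "GM_star T L F r =
     Min {A \<in> F. \<forall>B\<in>F. perceived_cost T L r A \<le> perceived_cost T L r B}"

text \<open>
  In the following, \<open>x\<close> is the report vector of the strategic clients; its values outside
  \<open>strategic I\<close> are irrelevant because the truthful clients' reports are their true locations.
\<close>

definition outcome :: "mechanism \<Rightarrow> line_instance \<Rightarrow> (nat \<Rightarrow> real) \<Rightarrow> real" where
  "outcome M I x =
     M (truthful I) (strategic I) (facilities I) (override_on (loc I) x (strategic I))"

definition strong_Nash :: "mechanism \<Rightarrow> line_instance \<Rightarrow> (nat \<Rightarrow> real) \<Rightarrow> bool" where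
  "strong_Nash M I x \<longleftrightarrow>
     (\<forall>J x'. J \<noteq> {} \<and> J \<subseteq> strategic I \<longrightarrow>
        (\<exists>i\<in>J. dist (loc I i) (outcome M I (override_on x x' J))
              \<ge> dist (loc I i) (outcome M I x)))"

definition strong_Nash_facilities :: "mechanism \<Rightarrow> line_instance \<Rightarrow> real set" where
  "strong_Nash_facilities M I =
     {A \<in> facilities I. \<exists>x. strong_Nash M I x \<and> outcome M I x = A}"

definition true_cost :: "line_instance \<Rightarrow> real \<Rightarrow> real" where
  "true_cost I A = (\<Sum>i\<in>clients I. dist (loc I i) A)"

definition optimal_facility :: "line_instance \<Rightarrow> real" where
  "optimal_facility I = arg_min_on (true_cost I) (facilities I)"

text \<open>
  If the optimal cost is \<open>0\<close>, then \<open>0 / 0\<close> is read as \<open>1\<close> (a facility as cheap as the optimum has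
  ratio \<open>1\<close>), and \<open>c / 0 = \<infinity>\<close> for \<open>c > 0\<close>, by the division on \<^typ>\<open>ereal\<close>.
\<close>

definition cost_ratio :: "line_instance \<Rightarrow> real \<Rightarrow> ereal" where
  "cost_ratio I A =
     (let c = true_cost I A; opt = true_cost I (optimal_facility I)
      in if c = opt then 1 else ereal c / ereal opt)"

text \<open>
  In \<^typ>\<open>ereal\<close>, the infimum over the empty set is \<open>\<infinity>\<close>: a finite upper bound on the strong price
  of stability of an instance entails that a strong Nash equilibrium exists.
\<close>

definition instance_strong_PoS :: "mechanism \<Rightarrow> line_instance \<Rightarrow> ereal" where
  "instance_strong_PoS M I = (INF A\<in>strong_Nash_facilities M I. cost_ratio I A)"

definition instance_strong_PoA :: "mechanism \<Rightarrow> line_instance \<Rightarrow> ereal" where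
  "instance_strong_PoA M I = (SUP A\<in>strong_Nash_facilities M I. cost_ratio I A)"

definition strong_PoS :: "mechanism \<Rightarrow> nat \<Rightarrow> nat \<Rightarrow> ereal" where
  "strong_PoS M n k = (SUP I\<in>line_instances n k. instance_strong_PoS M I)"

definition strong_PoA :: "mechanism \<Rightarrow> nat \<Rightarrow> nat \<Rightarrow> ereal" where
  "strong_PoA M n k = (SUP I\<in>line_instances n k. instance_strong_PoA M I)"

definition GM_star_bound :: "nat \<Rightarrow> nat \<Rightarrow> real" where
  "GM_star_bound n k =
     (if real k \<le> real n / 2 then (real n + real k) / (real n - real k) else 3)"

end

theory Submission
  imports Defs
begin

text \<open>
  The reported cost is convex in the facility. Hence if \<open>A\<close> is the outcome of a strong Nash
  equilibrium and \<open>Q\<close> another facility, then \<open>Q\<close> cannot beat \<open>A\<close> even when all strategic clients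
  that strictly prefer \<open>Q\<close> report \<open>Q\<close>: otherwise the outcome would move into the interval between
  \<open>A\<close> and \<open>Q\<close>, \<open>A\<close> excluded, which all of them prefer to \<open>A\<close>. Say \<open>a\<close> of the strategic clients
  weakly prefer \<open>A\<close> to \<open>Q\<close>. Triangle inequalities then bound the ratio of the true costs of \<open>A\<close> and
  \<open>Q\<close> by \<open>(n + a) / (n - a)\<close> if \<open>2 a \<le> n\<close>, and by \<open>1 + 2 (n - a) / a \<le> 3\<close> otherwise.

  An equilibrium is obtained at the leftmost facility \<open>A\<close> that is not beaten by a facility to its
  right when the clients that would like to move right from \<open>A\<close> report the rightmost facility and
  all others the leftmost one.
\<close>

section \<open>Reported costs and the outcome as their leftmost minimizer\<close>

text \<open>A single sum over all clients, so that pointwise inequalities between distances can be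
  summed in one step.\<close>

definition reported_cost :: "line_instance \<Rightarrow> (nat \<Rightarrow> real) \<Rightarrow> real \<Rightarrow> real" where
  "reported_cost I x A = (\<Sum>i\<in>clients I. dist (override_on (loc I) x (strategic I) i) A)"

lemma line_instancesD:
  assumes "I \<in> line_instances n k"
  shows "finite (truthful I)" "finite (strategic I)" "truthful I \<inter> strategic I = {}"
    "finite (clients I)" "card (clients I) = n" "card (strategic I) = k"
    "finite (facilities I)" "facilities I \<noteq> {}" "card (truthful I) = n - k" "k \<le> n"
proof -
  show *: "finite (truthful I)" "finite (strategic I)" "truthful I \<inter> strategic I = {}"
    "finite (clients I)" "card (clients I) = n" "card (strategic I) = k"
    "finite (facilities I)" "facilities I \<noteq> {}"
    using assms by (auto simp: line_instances_def clients_def)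
  have "n = card (truthful I) + k"
    using * card_Un_disjoint[of "truthful I" "strategic I"] by (simp add: clients_def)
  then show "card (truthful I) = n - k" "k \<le> n" by auto
qed

lemma outcome_eq_Min:
  assumes "I \<in> line_instances n k"
  shows "outcome GM_star I x =
    Min {A \<in> facilities I. \<forall>B\<in>facilities I. reported_cost I x A \<le> reported_cost I x B}"
proof -
  note I = line_instancesD[OF assms]
  have "perceived_cost (truthful I) (strategic I) (override_on (loc I) x (strategic I)) =
    reported_cost I x"
    using I by (auto simp: fun_eq_iff perceived_cost_def reported_cost_def clients_def
        sum.union_disjoint)
  then show ?thesis by (simp add: outcome_def GM_star_def)
qed

lemma outcome_props:
  assumes "I \<in> line_instances n k"
  shows outcome_in: "outcome GM_star I x \<in> facilities I"
    and outcome_le: "B \<in> facilities I \<Longrightarrow>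
      reported_cost I x (outcome GM_star I x) \<le> reported_cost I x B"
    and outcome_less: "B \<in> facilities I \<Longrightarrow> B < outcome GM_star I x \<Longrightarrow>
      reported_cost I x (outcome GM_star I x) < reported_cost I x B"
proof -
  note I = line_instancesD[OF assms]
  let ?M = "{A \<in> facilities I. \<forall>B\<in>facilities I. reported_cost I x A \<le> reported_cost I x B}"
  have fin: "finite ?M" using I by auto
  obtain m where "m \<in> facilities I" "\<forall>B\<in>facilities I. reported_cost I x m \<le> reported_cost I x B"
    using I ex_min_if_finite[of "reported_cost I x ` facilities I"]
    by (force simp: not_less)
  then have "?M \<noteq> {}" by blast
  then have "outcome GM_star I x \<in> ?M"
    using Min_in[OF fin] outcome_eq_Min[OF assms] by simp
  then show "outcome GM_star I x \<in> facilities I"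
    and le: "\<And>B. B \<in> facilities I \<Longrightarrow>
      reported_cost I x (outcome GM_star I x) \<le> reported_cost I x B"
    by auto
  assume B: "B \<in> facilities I" "B < outcome GM_star I x"
  then have "B \<notin> ?M"
    using Min_le[OF fin, of B] outcome_eq_Min[OF assms, of x] by force
  then obtain C where "C \<in> facilities I" "reported_cost I x C < reported_cost I x B"
    using B by force
  with le[of C] show "reported_cost I x (outcome GM_star I x) < reported_cost I x B" by simp
qed

lemma outcome_eqI:
  assumes "I \<in> line_instances n k" "A \<in> facilities I"
    and "\<And>B. B \<in> facilities I \<Longrightarrow> A < B \<Longrightarrow> reported_cost I x A \<le> reported_cost I x B"
    and "\<And>B. B \<in> facilities I \<Longrightarrow> B < A \<Longrightarrow> reported_cost I x A < reported_cost I x B"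
  shows "outcome GM_star I x = A"
proof (rule ccontr)
  let ?W = "outcome GM_star I x"
  assume "?W \<noteq> A"
  then consider "A < ?W" | "?W < A" by linarith
  then show False
  proof cases
    case 1
    with outcome_less[OF assms(1,2), of x] assms(3)[OF outcome_in[OF assms(1)], of x]
    show False by simp
  next
    case 2
    with outcome_le[OF assms(1,2), of x] assms(4)[OF outcome_in[OF assms(1)], of x]
    show False by simp
  qed
qed

section \<open>Convexity of the reported cost in the facility\<close>

lemma dist_real_convex:
  fixes r :: real
  assumes "A < B" "B < C"
  shows "dist r B * (C - A) \<le> dist r A * (C - B) + dist r C * (B - A)"
proof -
  have "dist r B * (C - A) = \<bar>(r - A) * (C - B) + (r - C) * (B - A)\<bar>"
  proof -
    have "(r - A) * (C - B) + (r - C) * (B - A) = (r - B) * (C - A)" by (simp add: algebra_simps)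
    then show ?thesis using assms by (simp add: dist_real_def abs_mult)
  qed
  also have "\<dots> \<le> \<bar>(r - A) * (C - B)\<bar> + \<bar>(r - C) * (B - A)\<bar>" by (rule abs_triangle_ineq)
  finally show ?thesis using assms by (simp add: dist_real_def abs_mult)
qed

lemma reported_cost_convex:
  assumes "A < B" "B < C"
  shows "reported_cost I x B * (C - A) \<le>
    reported_cost I x A * (C - B) + reported_cost I x C * (B - A)"
  unfolding reported_cost_def sum_distrib_right sum.distrib[symmetric]
  by (rule sum_mono) (rule dist_real_convex[OF assms])

text \<open>The slope of a convex function on \<open>[A, B]\<close> is at most its slope on
  \<open>[B, C]\<close>; \<open>*\<close> is this with denominators cleared.\<close>

lemma reported_cost_right:
  assumes "A < B" "B < C"
  shows "reported_cost I x A \<le> reported_cost I x B \<Longrightarrow> reported_cost I x B \<le> reported_cost I x C"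
    and "reported_cost I x A < reported_cost I x B \<Longrightarrow> reported_cost I x B < reported_cost I x C"
proof -
  let ?f = "reported_cost I x"
  have *: "(?f B - ?f A) * (C - B) \<le> (?f C - ?f B) * (B - A)"
    using reported_cost_convex[OF assms, of I x] by (simp add: algebra_simps)
  show "?f B \<le> ?f C" if "?f A \<le> ?f B"
  proof -
    have "0 \<le> (?f B - ?f A) * (C - B)" using that assms by simp
    with * have "0 \<le> (?f C - ?f B) * (B - A)" by linarith
    then show ?thesis using assms by (simp add: zero_le_mult_iff)
  qed
  show "?f B < ?f C" if "?f A < ?f B"
  proof -
    have "0 < (?f B - ?f A) * (C - B)" using that assms by simp
    with * have "0 < (?f C - ?f B) * (B - A)" by linarith
    then show ?thesis using assms by (simp add: zero_less_mult_iff)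
  qed
qed

lemma reported_cost_left:
  assumes "A < B" "B < C"
  shows "reported_cost I x C < reported_cost I x B \<Longrightarrow> reported_cost I x B < reported_cost I x A"
  using reported_cost_right(1)[OF assms, of I x] by linarith

text \<open>Truthful clients contribute the same to both differences. This transfers a comparison of
  two facilities from one profile to another.\<close>

lemma reported_cost_diff_mono:
  assumes "\<And>i. i \<in> strategic I \<Longrightarrow> dist (x i) P - dist (x i) Q \<le> dist (y i) P - dist (y i) Q"
  shows "reported_cost I x P - reported_cost I x Q \<le> reported_cost I y P - reported_cost I y Q"
  unfolding reported_cost_def sum_subtractf[symmetric]
  by (rule sum_mono) (use assms in \<open>auto simp: override_on_def\<close>)

section \<open>Upper bound on the cost of an equilibrium\<close>

lemma strong_Nash_no_switch:
  assumes I: "I \<in> line_instances n k"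
    and x: "strong_Nash GM_star I x" "outcome GM_star I x = A"
    and Q: "Q \<in> facilities I" "Q \<noteq> A"
    and J: "J = {i\<in>strategic I. dist (loc I i) Q < dist (loc I i) A}"
  shows "reported_cost I (override_on x (\<lambda>_. Q) J) A \<le> reported_cost I (override_on x (\<lambda>_. Q) J) Q"
proof (rule ccontr)
  let ?y = "override_on x (\<lambda>_. Q) J"
  let ?f = "reported_cost I x" and ?g = "reported_cost I ?y"
  define W where "W = outcome GM_star I ?y"
  note A = outcome_props[OF I, where x = x, unfolded x(2)]
  note W = outcome_props[OF I, where x = ?y, folded W_def]
  assume "\<not> ?g A \<le> ?g Q"
  then have less: "?g Q < ?g A" by simp
  have "J \<noteq> {}" using less A(2)[OF Q(1)] by (auto simp: override_on_def)
  \<comment> \<open>Reports at Q favour every point over the points behind it as seen from Q.\<close>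
  have pull: "?f P - ?f R \<le> ?g P - ?g R" if "P \<le> R \<and> R \<le> Q \<or> Q \<le> R \<and> R \<le> P" for P R
    by (rule reported_cost_diff_mono) (use that in \<open>auto simp: override_on_def dist_real_def\<close>)
  have "W \<noteq> A" using less W(2)[OF Q(1)] by auto
  \<comment> \<open>Behind \<open>A\<close> no facility beats \<open>A\<close> under
    \<open>x\<close>; beyond \<open>Q\<close>, convexity continues the growth of \<open>?f\<close>
    from \<open>A\<close> to \<open>Q\<close>. In each case \<open>pull\<close> carries the
    comparison over to \<open>?g\<close>, and tie-breaking makes one of the combined inequalities
    strict.\<close>
  have between: "A < W \<and> W \<le> Q \<or> Q \<le> W \<and> W < A"
  proof (cases "A < Q")
    case True
    have "\<not> W < A"
      using pull[of W A] True A(3)[OF W(1)] W(2)[OF A(1)] by auto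
    moreover have "\<not> Q < W"
      using pull[of W Q] W(3)[OF Q(1)]
        reported_cost_right(1)[where A = A and B = Q and C = W and I = I and x = x]
        True A(2)[OF Q(1)] by auto
    ultimately show ?thesis using \<open>W \<noteq> A\<close> by auto
  next
    case False
    then have "Q < A" using Q by auto
    have "\<not> A < W"
      using pull[of W A] \<open>Q < A\<close> A(2)[OF W(1)] W(3)[OF A(1)] by auto
    moreover have "\<not> W < Q"
      using pull[of W Q] W(2)[OF Q(1)]
        reported_cost_left[where A = W and B = Q and C = A and I = I and x = x] \<open>Q < A\<close>
        A(3)[OF Q(1) \<open>Q < A\<close>] by auto
    ultimately show ?thesis using \<open>W \<noteq> A\<close> by auto
  qed
  \<comment> \<open>A client in \<open>J\<close> lies on the \<open>Q\<close> side of the midpoint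
    of \<open>A\<close> and \<open>Q\<close>, hence also on the \<open>W\<close> side of the
    midpoint of \<open>A\<close> and \<open>W\<close>.\<close>
  have "dist (loc I i) W < dist (loc I i) A" if "i \<in> J" for i
    using that between unfolding J by (auto simp: dist_real_def)
  moreover have "J \<subseteq> strategic I" unfolding J by auto
  ultimately show False
    using x \<open>J \<noteq> {}\<close> unfolding strong_Nash_def W_def by (meson not_le)
qed

text \<open>The quotient increases with \<open>a\<close> and equals 3 at
  \<open>a = n / 2\<close>.\<close>

lemma GM_star_bound_ge:
  assumes "a \<le> k" "k \<le> n" "1 \<le> n" "2 * a \<le> n"
  shows "(real n + real a) / (real n - real a) \<le> GM_star_bound n k"
proof (cases "real k \<le> real n / 2")
  case True
  have "(real n + real a) / (real n - real a) \<le> (real n + real k) / (real n - real k)"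
    by (rule frac_le) (use assms True in auto)
  with True show ?thesis by (simp add: GM_star_bound_def)
next
  case False
  have "(real n + real a) \<le> 3 * (real n - real a)"
    using of_nat_mono[OF assms(4), where ?'a = real] by simp
  moreover have "0 < real n - real a" using assms by simp
  ultimately show ?thesis using False by (simp add: GM_star_bound_def pos_divide_le_eq)
qed

lemma strong_Nash_cost_le:
  assumes I: "I \<in> line_instances n k" and n: "1 \<le> n"
    and x: "strong_Nash GM_star I x" "outcome GM_star I x = A"
    and Q: "Q \<in> facilities I" "Q \<noteq> A"
  shows "true_cost I A \<le> GM_star_bound n k * true_cost I Q"
proof -
  note Is = line_instancesD[OF I]
  define J where "J = {i\<in>strategic I. dist (loc I i) Q < dist (loc I i) A}"
  define R where "R = strategic I - J"
  let ?T = "truthful I" and ?D = "dist Q A"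
  let ?l = "loc I" and ?y = "override_on x (\<lambda>_. Q) J"
  define a where "a = card R"
  define b where "b = card J"
  have D: "?D > 0" using Q by simp
  have fin: "finite J" "finite R" using Is by (auto simp: J_def R_def)
  have strat: "strategic I = R \<union> J" "R \<inter> J = {}" by (auto simp: J_def R_def)
  have k: "k = a + b"
    using Is card_Un_disjoint[OF fin(2,1) strat(2)] strat(1) by (simp add: a_def b_def)
  have split: "sum h (clients I) = sum h ?T + sum h R + sum h J" for h :: "nat \<Rightarrow> real"
  proof -
    have "sum h (clients I) = sum h ?T + sum h (strategic I)"
      unfolding clients_def using Is by (intro sum.union_disjoint) auto
    also have "sum h (strategic I) = sum h R + sum h J"
      unfolding strat(1) using fin strat(2) by (intro sum.union_disjoint) auto
    finally show ?thesis by simp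
  qed
  define tA tQ rA rQ jA jQ where
    "tA = (\<Sum>i\<in>?T. dist (?l i) A)" and "tQ = (\<Sum>i\<in>?T. dist (?l i) Q)" and
    "rA = (\<Sum>i\<in>R. dist (?l i) A)" and "rQ = (\<Sum>i\<in>R. dist (?l i) Q)" and
    "jA = (\<Sum>i\<in>J. dist (?l i) A)" and "jQ = (\<Sum>i\<in>J. dist (?l i) Q)"
  note defs = tA_def tQ_def rA_def rQ_def jA_def jQ_def
  have cA: "true_cost I A = tA + rA + jA" and cQ: "true_cost I Q = tQ + rQ + jQ"
    unfolding true_cost_def split defs by auto
  \<comment> \<open>When \<open>J\<close> reports \<open>Q\<close>, it adds \<open>b * ?D\<close> to
    the cost of \<open>A\<close> and nothing to that of \<open>Q\<close>, while each report in
    \<open>R\<close> favours \<open>A\<close> by at most \<open>?D\<close>.\<close>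
  have t1: "tA - tQ \<le> (real a - real b) * ?D"
  proof -
    have T: "override_on ?l ?y (strategic I) i = ?l i" if "i \<in> ?T" for i
      using that Is(3) by (auto simp: override_on_def)
    have R: "override_on ?l ?y (strategic I) i = x i" if "i \<in> R" for i
      using that by (auto simp: override_on_def R_def)
    have J: "override_on ?l ?y (strategic I) i = Q" if "i \<in> J" for i
      using that by (auto simp: override_on_def J_def)
    have eq: "reported_cost I ?y P = (\<Sum>i\<in>?T. dist (?l i) P) + (\<Sum>i\<in>R. dist (x i) P) + b * dist Q P" for P
      unfolding reported_cost_def split by (simp add: T R J b_def)
    have "tA + (\<Sum>i\<in>R. dist (x i) A) + b * ?D \<le> tQ + (\<Sum>i\<in>R. dist (x i) Q)"
      using strong_Nash_no_switch[OF I x Q J_def] by (simp add: eq defs)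
    moreover have "(\<Sum>i\<in>R. dist (x i) Q) \<le> (\<Sum>i\<in>R. dist (x i) A + ?D)"
      by (rule sum_mono) (metis dist_commute dist_triangle)
    ultimately show ?thesis by (simp add: sum.distrib a_def algebra_simps)
  qed
  have T: "real (card ?T) = real n - real k" using Is by simp
  have "tA \<le> (\<Sum>i\<in>?T. dist (?l i) Q + ?D)" unfolding defs
    by (rule sum_mono) (metis dist_triangle)
  then have t2: "tA - tQ \<le> (real n - real k) * ?D" by (simp add: sum.distrib defs T)
  have "(\<Sum>i\<in>?T. ?D) \<le> (\<Sum>i\<in>?T. dist (?l i) A + dist (?l i) Q)"
    by (rule sum_mono) (metis add.commute dist_triangle3)
  then have t3: "(real n - real k) * ?D \<le> tA + tQ" by (simp add: sum.distrib defs T)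
  have r1: "rA \<le> rQ" unfolding defs by (rule sum_mono) (auto simp: R_def J_def)
  have "(\<Sum>i\<in>R. ?D) \<le> (\<Sum>i\<in>R. dist (?l i) A + dist (?l i) Q)"
    by (rule sum_mono) (metis add.commute dist_triangle3)
  then have r2: "a * ?D \<le> rA + rQ" by (simp add: sum.distrib defs a_def)
  have "jA \<le> (\<Sum>i\<in>J. dist (?l i) Q + ?D)" unfolding defs
    by (rule sum_mono) (metis dist_triangle)
  then have j1: "jA - jQ \<le> b * ?D" by (simp add: sum.distrib defs b_def)
  have j2: "0 \<le> jQ" "0 \<le> tQ" unfolding defs by (auto intro: sum_nonneg)
  have kr: "real k = real a + real b" using k by simp
  have dQ: "0 \<le> true_cost I Q" by (simp add: true_cost_def sum_nonneg)
  show ?thesis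
  \<comment> \<open>If \<open>2 * a \<le> n\<close>, \<open>A\<close> exceeds \<open>Q\<close> by at
    most \<open>a * ?D\<close>, and \<open>Q\<close> costs at least \<open>(n - a) * ?D / 2\<close>.
    Otherwise the excess is at most \<open>(n - a) * ?D\<close>, and the clients in \<open>R\<close>
    alone, each at least \<open>?D / 2\<close> away from \<open>Q\<close>, give \<open>Q\<close> a
    cost of at least \<open>a * ?D / 2\<close>.\<close>
  proof (cases "2 * a \<le> n")
    case True
    have pos: "0 < real n - real a" using True n by linarith
    have diff: "true_cost I A - true_cost I Q \<le> a * ?D"
      using t1 r1 j1 unfolding cA cQ by (simp add: algebra_simps)
    have "(real n - real a) * ?D \<le> 2 * true_cost I Q"
      using t1 t3 r1 r2 j2 unfolding cQ kr by (simp add: algebra_simps)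
    then have "a * ((real n - real a) * ?D) \<le> a * (2 * true_cost I Q)"
      by (rule mult_left_mono) simp
    moreover have "(real n - real a) * (true_cost I A - true_cost I Q) \<le> (real n - real a) * (a * ?D)"
      using diff pos by (intro mult_left_mono) auto
    ultimately have "(real n - real a) * true_cost I A \<le> (real n + real a) * true_cost I Q"
      by (simp add: algebra_simps)
    then have "true_cost I A \<le> (real n + real a) / (real n - real a) * true_cost I Q"
      using pos by (simp add: field_simps)
    also have "\<dots> \<le> GM_star_bound n k * true_cost I Q"
      using GM_star_bound_ge[of a k n] True k Is(10) n dQ by (intro mult_right_mono) auto
    finally show ?thesis .
  next
    case False
    have "true_cost I A - true_cost I Q \<le> (real n - real a) * ?D"
      using t2 r1 j1 unfolding cA cQ kr by (simp add: algebra_simps)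
    also have "\<dots> \<le> a * ?D" using False D by (intro mult_right_mono) auto
    also have "\<dots> \<le> 2 * true_cost I Q" using r1 r2 j2 unfolding cQ by simp
    finally have "true_cost I A \<le> 3 * true_cost I Q" by simp
    moreover have "GM_star_bound n k = 3" using False k by (simp add: GM_star_bound_def)
    ultimately show ?thesis by simp
  qed
qed

lemma optimal_facility:
  assumes "I \<in> line_instances n k"
  shows "optimal_facility I \<in> facilities I"
    "\<And>B. B \<in> facilities I \<Longrightarrow> true_cost I (optimal_facility I) \<le> true_cost I B"
  using arg_min_if_finite[OF line_instancesD(7,8)[OF assms], of "true_cost I"]
  unfolding optimal_facility_def by (auto simp: not_less)

lemma one_le_GM_star_bound:
  assumes "1 \<le> n" "k \<le> n"
  shows "1 \<le> GM_star_bound n k"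
  using GM_star_bound_ge[of 0 k n] assms by simp

lemma instance_strong_PoA_le:
  assumes I: "I \<in> line_instances n k" and n: "1 \<le> n"
  shows "instance_strong_PoA GM_star I \<le> ereal (GM_star_bound n k)"
  unfolding instance_strong_PoA_def
proof (rule SUP_least)
  fix A assume "A \<in> strong_Nash_facilities GM_star I"
  then obtain x where x: "strong_Nash GM_star I x" "outcome GM_star I x = A"
    by (auto simp: strong_Nash_facilities_def)
  let ?O = "optimal_facility I"
  have b: "1 \<le> GM_star_bound n k" using one_le_GM_star_bound n line_instancesD(10)[OF I] by blast
  show "cost_ratio I A \<le> ereal (GM_star_bound n k)"
  proof (cases "true_cost I A = true_cost I ?O")
    case True
    then show ?thesis using b by (simp add: cost_ratio_def one_ereal_def)
  next
    case False
    then have ne: "?O \<noteq> A" by auto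
    have le: "true_cost I A \<le> GM_star_bound n k * true_cost I ?O"
      by (rule strong_Nash_cost_le[OF I n x optimal_facility(1)[OF I] ne])
    have "0 \<le> true_cost I A" "0 \<le> true_cost I ?O" by (simp_all add: true_cost_def sum_nonneg)
    \<comment> \<open>An optimum of cost 0 would force \<open>A\<close> to cost 0 as well, so an
      infinite ratio cannot occur.\<close>
    then have "0 < true_cost I ?O" using le False by (cases "true_cost I ?O = 0") auto
    then show ?thesis using le False by (simp add: cost_ratio_def pos_divide_le_eq)
  qed
qed

section \<open>Existence of a strong Nash equilibrium\<close>

lemma strong_Nash_exists:
  assumes I: "I \<in> line_instances n k"
  shows "\<exists>x. strong_Nash GM_star I x"
proof -
  let ?F = "facilities I" and ?f = "reported_cost I"
  note F = line_instancesD(7,8)[OF I]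
  define U where "U A = {i. \<exists>C\<in>?F. A < C \<and> dist (loc I i) C < dist (loc I i) A}" for A
  define V where "V A = {i. \<exists>C\<in>?F. C < A \<and> dist (loc I i) C < dist (loc I i) A}" for A
  \<comment> \<open>\<open>z\<close> is the test profile that selects \<open>A\<close>;
    \<open>y A\<close> is the equilibrium. They differ only in that clients content with
    \<open>A\<close> report \<open>A\<close> in \<open>y A\<close>.\<close>
  define z where "z A = (\<lambda>i. if i \<in> U A then Max ?F else Min ?F)" for A
  define y where "y A = (\<lambda>i. if i \<in> U A then Max ?F else if i \<in> V A then Min ?F else A)" for A
  have Min: "Min ?F \<le> A" and Max: "A \<le> Max ?F" if "A \<in> ?F" for A using that F by auto
  have UV: "U A \<inter> V A = {}" for A unfolding U_def V_def dist_real_def by auto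
  define G where "G = {A\<in>?F. \<forall>C\<in>?F. A < C \<longrightarrow> ?f (z A) A \<le> ?f (z A) C}"
  have "Max ?F \<in> G" using F Max by (auto simp: G_def not_less[symmetric])
  moreover have finG: "finite G" using F by (simp add: G_def)
  ultimately have "Min G \<in> G" by (intro Min_in) auto
  define A where "A = Min G"
  have A: "A \<in> ?F" and AC: "\<And>C. C \<in> ?F \<Longrightarrow> A < C \<Longrightarrow> ?f (z A) A \<le> ?f (z A) C"
    using \<open>Min G \<in> G\<close> by (auto simp: A_def G_def)
  \<comment> \<open>Clients outside \<open>U A\<close> report at or left of \<open>A\<close> in both
    profiles, so they favour \<open>A\<close> over \<open>C\<close> equally.\<close>
  have right: "?f (y A) A \<le> ?f (y A) C" if C: "C \<in> ?F" "A < C" for C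
  proof -
    have "?f (z A) C - ?f (z A) A \<le> ?f (y A) C - ?f (y A) A"
      by (rule reported_cost_diff_mono)
        (use C Min[OF A] in \<open>auto simp: z_def y_def dist_real_def\<close>)
    with AC[OF C] show ?thesis by simp
  qed
  have left: "?f (y A) A < ?f (y A) E" if E: "E \<in> ?F" "E < A" for E
  proof -
    \<comment> \<open>\<open>D\<close> is the left neighbour of \<open>A\<close>. By minimality of
      \<open>A\<close> it fails the test, so some \<open>C\<close> to its right beats it; as
      \<open>A \<le> C\<close>, convexity shows that \<open>A\<close> beats \<open>D\<close> and
      then every \<open>E\<close> further left, all under \<open>z D\<close>.\<close>
    define D where "D = Max {D\<in>?F. D < A}"
    have finD: "finite {D\<in>?F. D < A}" using F by simp
    have "D \<in> {D\<in>?F. D < A}" unfolding D_def by (rule Max_in) (use E finD in auto)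
    then have D: "D \<in> ?F" "D < A" by auto
    have D_max: "B \<le> D" if "B \<in> ?F" "B < A" for B
      unfolding D_def by (rule Max_ge) (use finD that in auto)
    have "D \<notin> G" using D(2) Min_le[OF finG, of D] by (auto simp: A_def)
    then obtain C where C: "C \<in> ?F" "D < C" "?f (z D) C < ?f (z D) D"
      using D by (auto simp: G_def not_le)
    have "A \<le> C" using D_max[OF C(1)] C(2) by linarith
    have AD: "?f (z D) A < ?f (z D) D"
    proof (cases "A = C")
      case False
      then show ?thesis
        using
          reported_cost_right(1)[where A = D and B = A and C = C and I = I and x = "z D"]
          D(2) \<open>A \<le> C\<close> C(3) by linarith
    qed (use C in simp)
    have "?f (z D) A < ?f (z D) E"
    proof (cases "E = D")
      case False
      then have "E < D" using D_max[OF E] by simp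
      then show ?thesis
        using reported_cost_left[where A = E and B = D and C = A and I = I and x = "z D"] D(2) AD by simp
    qed (use AD in simp)
    moreover have "?f (z D) E - ?f (z D) A \<le> ?f (y A) E - ?f (y A) A"
    proof (rule reported_cost_diff_mono)
      fix i
      show "dist (z D i) E - dist (z D i) A \<le> dist (y A i) E - dist (y A i) A"
      proof (cases "i \<in> U D")
        case True
        \<comment> \<open>Otherwise the client would lie strictly on both sides of the midpoint of
          \<open>D\<close> and \<open>A\<close>. Hence it reports at or right of \<open>A\<close>,
          which favours \<open>A\<close> over \<open>E\<close> as much as possible.\<close>
        have "i \<notin> V A"
        proof
          assume "i \<in> V A"
          then obtain B where B: "B \<in> ?F" "B < A" "dist (loc I i) B < dist (loc I i) A"
            by (auto simp: V_def)
          obtain B' where B': "B' \<in> ?F" "D < B'" "dist (loc I i) B' < dist (loc I i) D"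
            using True by (auto simp: U_def)
          have "B \<le> D" using D_max B by simp
          moreover have "A \<le> B'" using D_max[OF B'(1)] B'(2) by linarith
          ultimately show False using B B' D(2) by (auto simp: dist_real_def)
        qed
        then have "A \<le> y A i" using Max[OF A] by (auto simp: y_def)
        then show ?thesis using E(2) by (auto simp: dist_real_def)
      next
        case False
        then show ?thesis using E Min[OF E(1)] by (auto simp: z_def dist_real_def)
      qed
    qed
    ultimately show ?thesis by simp
  qed
  have out: "outcome GM_star I (y A) = A" by (rule outcome_eqI[OF I A right left])
  have "strong_Nash GM_star I (y A)"
    unfolding strong_Nash_def
  proof (intro allI impI, rule ccontr)
    fix J x'
    assume J: "J \<noteq> {} \<and> J \<subseteq> strategic I"
    let ?x = "override_on (y A) x' J"
    define W where "W = outcome GM_star I ?x"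
    note W = outcome_props[OF I, where x = ?x, folded W_def]
    assume "\<not> (\<exists>i\<in>J. dist (loc I i) (outcome GM_star I (y A)) \<le> dist (loc I i) (outcome GM_star I ?x))"
    then have pref: "dist (loc I i) W < dist (loc I i) A" if "i \<in> J" for i
      using that by (auto simp: out W_def[symmetric] not_le)
    have "W \<noteq> A" using pref J by auto
    then consider "A < W" | "W < A" by linarith
    then show False
    proof cases
      case 1
      \<comment> \<open>The deviators already report the extreme facility on the side of
        \<open>W\<close>, so no other report helps \<open>W\<close> more against \<open>A\<close>.
        The case \<open>W < A\<close> is symmetric.\<close>
      have "J \<subseteq> U A" using pref 1 W(1) by (auto simp: U_def)
      then have "?f (y A) W - ?f (y A) A \<le> ?f ?x W - ?f ?x A"
        by (intro reported_cost_diff_mono)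
          (use 1 Max[OF W(1)] in \<open>auto simp: y_def override_on_def dist_real_def\<close>)
      with right[OF W(1) 1] W(3)[OF A 1] show False by simp
    next
      case 2
      have "J \<subseteq> V A" using pref 2 W(1) by (auto simp: V_def)
      then have "J \<subseteq> V A" "J \<inter> U A = {}" using UV by blast+
      then have "?f (y A) W - ?f (y A) A \<le> ?f ?x W - ?f ?x A"
        by (intro reported_cost_diff_mono)
          (use 2 Min[OF W(1)] in \<open>auto simp: y_def override_on_def dist_real_def\<close>)
      with left[OF W(1) 2] W(2)[OF A] show False by simp
    qed
  qed
  then show ?thesis by blast
qed

section \<open>Comparison of the two prices and their upper bounds\<close>

text \<open>Existence of an equilibrium is essential: over the empty set the infimum is \<infinity>
  and the supremum -\<infinity>.\<close>

lemma instance_strong_PoS_le_PoA: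
  assumes I: "I \<in> line_instances n k"
  shows "instance_strong_PoS GM_star I \<le> instance_strong_PoA GM_star I"
proof -
  obtain x where "strong_Nash GM_star I x" using strong_Nash_exists[OF I] by blast
  then have "strong_Nash_facilities GM_star I \<noteq> {}"
    using outcome_in[OF I] by (auto simp: strong_Nash_facilities_def)
  then show ?thesis
    unfolding instance_strong_PoS_def instance_strong_PoA_def by (rule INF_le_SUP)
qed

lemma strong_PoS_le_PoA: "strong_PoS GM_star n k \<le> strong_PoA GM_star n k"
  unfolding strong_PoS_def strong_PoA_def
  proof (rule SUP_mono)
  fix I assume "I \<in> line_instances n k"
  then show "\<exists>I'\<in>line_instances n k. instance_strong_PoS GM_star I \<le> instance_strong_PoA GM_star I'"
    using instance_strong_PoS_le_PoA by blast
qed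

lemma strong_PoA_le:
  assumes "1 \<le> n"
  shows "strong_PoA GM_star n k \<le> ereal (GM_star_bound n k)"
  unfolding strong_PoA_def using instance_strong_PoA_le[OF _ assms] by (rule SUP_least)

section \<open>Lower bounds from instances with two facilities\<close>

text \<open>The optimum costs at most as much as \<open>B\<close>, so a lower bound on the ratio
  does not require knowing which facility is optimal.\<close>

lemma cost_ratio_ge:
  assumes I: "I \<in> line_instances n k" and B: "B \<in> facilities I" "0 < true_cost I B"
  shows "ereal (true_cost I A / true_cost I B) \<le> cost_ratio I A"
proof -
  let ?c = "true_cost I" and ?O = "optimal_facility I"
  have le: "?c ?O \<le> ?c B" by (rule optimal_facility(2)[OF I B(1)])
  have nonneg: "0 \<le> ?c A" "0 \<le> ?c ?O" by (simp_all add: true_cost_def sum_nonneg)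
  consider "?c A = ?c ?O" | "?c A \<noteq> ?c ?O" "?c ?O = 0" | "?c A \<noteq> ?c ?O" "0 < ?c ?O"
    using nonneg by linarith
  then show ?thesis
  proof cases
    case 1
    then show ?thesis using le B by (simp add: cost_ratio_def one_ereal_def)
  next
    case 2
    then have "0 < ?c A" using nonneg by simp
    then show ?thesis using 2 by (simp add: cost_ratio_def)
  next
    case 3
    have "?c A / ?c B \<le> ?c A / ?c ?O" using 3 le nonneg by (intro divide_left_mono) auto
    then show ?thesis using 3 by (simp add: cost_ratio_def)
  qed
qed

text \<open>
  The \<open>m\<close> strategic clients slightly to the left of the midpoint of the facilities \<open>0\<close> and \<open>1\<close>
  can enforce \<open>0\<close> by reporting \<open>0\<close>, even if all other strategic clients report \<open>1\<close>.
\<close>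

lemma strong_PoS_ge:
  assumes m: "m \<le> k" "k \<le> n" and p: "1 / 2 \<le> p" "p \<le> 1" and d: "0 < \<delta>" "\<delta> < 1 / 2"
    and enforce: "(real n - real k) * (2 * p - 1) + (real k - real m) \<le> real m"
    and pos: "0 < (real n - real k) * (1 - p) + real m * (1 / 2 + \<delta>)"
  shows "ereal (((real n - real k) * p + (real k - real m) + real m * (1 / 2 - \<delta>)) /
      ((real n - real k) * (1 - p) + real m * (1 / 2 + \<delta>))) \<le> strong_PoS GM_star n k"
proof -
  define I where "I = \<lparr>truthful = {k..<n}, strategic = {..<k},
    loc = (\<lambda>i. if i < m then 1 / 2 - \<delta> else if i < k then 1 else p), facilities = {0, 1}\<rparr>"
  have cl: "clients I = {..<n}" using m by (auto simp: I_def clients_def)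
  have I: "I \<in> line_instances n k"
    unfolding line_instances_def mem_Collect_eq cl using m by (auto simp: I_def)
  have split: "sum h (clients I) = sum h {..<m} + sum h {m..<k} + sum h {k..<n}"
    for h :: "nat \<Rightarrow> real"
    using m unfolding cl lessThan_atLeast0
    by (simp only: sum.atLeastLessThan_concat le0 order_trans[OF m])
  have c0: "true_cost I 0 = (real n - real k) * p + (real k - real m) + real m * (1 / 2 - \<delta>)"
    using m p d unfolding true_cost_def split by (simp add: I_def dist_real_def of_nat_diff)
  have c1: "true_cost I 1 = (real n - real k) * (1 - p) + real m * (1 / 2 + \<delta>)"
    using m p d unfolding true_cost_def split by (simp add: I_def dist_real_def of_nat_diff)
  let ?J = "{..<m}"
  \<comment> \<open>\<open>enforce\<close> is the comparison of 0 with 1 when the other strategic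
    clients favour 1 as strongly as possible. Equality suffices, since ties go to 0.\<close>
  have enforced: "outcome GM_star I (override_on x (\<lambda>_. 0) ?J) = 0" for x
  proof (rule outcome_eqI[OF I])
    let ?y = "override_on x (\<lambda>_. 0) ?J"
    let ?r = "override_on (loc I) ?y (strategic I)"
    have r: "?r i = (if i < m then 0 else if i < k then x i else p)" for i
      using m by (auto simp: I_def override_on_def)
    have "reported_cost I ?y 0 - reported_cost I ?y 1 =
        (\<Sum>i\<in>clients I. dist (?r i) 0 - dist (?r i) 1)"
      by (simp add: reported_cost_def sum_subtractf)
    also have "\<dots> = - real m + (\<Sum>i=m..<k. dist (x i) 0 - dist (x i) 1) +
        (real n - real k) * (2 * p - 1)"
      using m p unfolding split by (simp add: r dist_real_def of_nat_diff)
    also have "(\<Sum>i=m..<k. dist (x i) 0 - dist (x i) 1) \<le> (\<Sum>i=m..<k. 1)"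
      by (rule sum_mono) (auto simp: dist_real_def)
    also have "(\<Sum>i=m..<k. 1) = real k - real m" using m by (simp add: of_nat_diff)
    finally have le: "reported_cost I ?y 0 \<le> reported_cost I ?y 1" using enforce by simp
    show "0 \<in> facilities I" by (simp add: I_def)
    show "reported_cost I ?y 0 \<le> reported_cost I ?y B" if "B \<in> facilities I" for B
      using that le by (auto simp: I_def)
    show "reported_cost I ?y 0 < reported_cost I ?y B" if "B \<in> facilities I" "B < 0" for B
      using that by (auto simp: I_def)
  qed
  have sub: "strong_Nash_facilities GM_star I \<subseteq> {0}"
  proof
    fix A assume "A \<in> strong_Nash_facilities GM_star I"
    then obtain x where x: "strong_Nash GM_star I x" "outcome GM_star I x = A" and A: "A = 0 \<or> A = 1"
      by (auto simp: strong_Nash_facilities_def I_def)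
    have "A \<noteq> 1"
    \<comment> \<open>At facility 1 the clients in \<open>?J\<close> could jointly report 0 and all
      strictly gain. If \<open>?J\<close> is empty, \<open>enforced\<close> already makes 0 the
      outcome of \<open>x\<close>.\<close>
    proof
      assume "A = 1"
      then have "?J \<noteq> {}" using enforced[of x] x(2) by (metis override_on_emptyset zero_neq_one)
      moreover have "?J \<subseteq> strategic I" using m by (auto simp: I_def)
      ultimately obtain i where i: "i < m" "dist (loc I i) A \<le> dist (loc I i) 0"
        using x enforced[of x] unfolding strong_Nash_def by (metis lessThan_iff)
      then show False using d \<open>A = 1\<close> by (auto simp: I_def dist_real_def)
    qed
    with A show "A \<in> {0}" by simp
  qed
  have one: "1 \<in> facilities I" by (simp add: I_def)
  have "ereal (true_cost I 0 / true_cost I 1) \<le> instance_strong_PoS GM_star I"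
    unfolding instance_strong_PoS_def
    using sub cost_ratio_ge[OF I one, of 0] pos unfolding c1 by (intro INF_greatest) auto
  also have "\<dots> \<le> strong_PoS GM_star n k"
    unfolding strong_PoS_def by (rule SUP_upper[OF I])
  finally show ?thesis unfolding c0 c1 .
qed

text \<open>At \<open>\<delta> = 0\<close> the \<open>m\<close> clients would be indifferent and
  could not be relied on to deviate, but the bounds for \<open>\<delta> > 0\<close> pass to the
  limit.\<close>

lemma strong_PoS_ge_limit:
  assumes m: "m \<le> k" "k \<le> n" and p: "1 / 2 \<le> p" "p \<le> 1"
    and enforce: "(real n - real k) * (2 * p - 1) + (real k - real m) \<le> real m"
    and pos: "0 < (real n - real k) * (1 - p) + real m / 2"
  shows "ereal (((real n - real k) * p + (real k - real m) + real m / 2) /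
      ((real n - real k) * (1 - p) + real m / 2)) \<le> strong_PoS GM_star n k"
proof (rule tendsto_upperbound)
  let ?g = "\<lambda>\<delta>. ((real n - real k) * p + (real k - real m) + real m * (1 / 2 - \<delta>)) /
      ((real n - real k) * (1 - p) + real m * (1 / 2 + \<delta>))"
  have "(?g \<longlongrightarrow> ?g 0) (at_right 0)" using pos by (intro tendsto_intros) auto
  then show "((\<lambda>\<delta>. ereal (?g \<delta>)) \<longlongrightarrow> ereal (((real n - real k) * p + (real k - real m) + real m / 2) /
      ((real n - real k) * (1 - p) + real m / 2))) (at_right 0)"
    by simp
  show "\<forall>\<^sub>F \<delta> in at_right 0. ereal (?g \<delta>) \<le> strong_PoS GM_star n k"
    unfolding eventually_at_right_field
  proof (intro exI[of _ "1 / 2"] conjI allI impI)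
    fix \<delta> :: real assume d: "0 < \<delta>" "\<delta> < 1 / 2"
    have "real m / 2 \<le> real m * (1 / 2 + \<delta>)" using d by (simp add: algebra_simps)
    with pos have "0 < (real n - real k) * (1 - p) + real m * (1 / 2 + \<delta>)" by linarith
    then show "ereal (?g \<delta>) \<le> strong_PoS GM_star n k"
      by (rule strong_PoS_ge[OF m p d enforce])
  qed simp
qed simp

text \<open>The error term covers the rounding of \<open>n / 2\<close> when
  \<open>k > n / 2\<close>; for \<open>k \<le> n / 2\<close> the bound itself is reached.\<close>

lemma strong_PoS_tight:
  assumes n: "1 \<le> n" and k: "k \<le> n"
  shows "ereal (GM_star_bound n k - 4 / (real n + 1)) \<le> strong_PoS GM_star n k"
proof (cases "real k \<le> real n / 2")
  case True
  \<comment> \<open>With \<open>m = k\<close>, this \<open>p\<close> makes the enforcement condition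
    an equality: the truthful clients favour 1 by exactly \<open>k\<close> in total.\<close>
  define p where "p = real n / 2 / (real n - real k)"
  have nk: "0 < real n - real k" using True n by simp
  have p: "1 / 2 \<le> p" "p \<le> 1" using True nk by (auto simp: p_def field_simps)
  have p': "(real n - real k) * p = real n / 2" using nk unfolding p_def by (simp del: right_diff_distrib_numeral)
  have q: "(real n - real k) * (1 - p) = real n / 2 - real k"
    using p' by (simp add: algebra_simps)
  have "(real n - real k) * (2 * p - 1) = real k"
    using p' by (simp add: algebra_simps)
  then have "ereal (((real n - real k) * p + (real k - real k) + real k / 2) /
      ((real n - real k) * (1 - p) + real k / 2)) \<le> strong_PoS GM_star n k"
    using k p nk by (intro strong_PoS_ge_limit) (auto simp: q)
  then have "ereal ((real n / 2 + real k / 2) / (real n / 2 - real k + real k / 2))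
      \<le> strong_PoS GM_star n k"
    unfolding p' q by simp
  also have "(real n / 2 + real k / 2) / (real n / 2 - real k + real k / 2) = GM_star_bound n k"
    using True nk by (simp add: GM_star_bound_def field_simps)
  finally have "ereal (GM_star_bound n k) \<le> strong_PoS GM_star n k" .
  then show ?thesis by (rule order_trans[rotated]) simp
next
  case False
  \<comment> \<open>With \<open>p = 1\<close> the enforcement condition reads
    \<open>n \<le> 2 * m\<close>; this is the least such \<open>m\<close>.\<close>
  define m where "m = (n + 1) div 2"
  have m: "m \<le> k" "n \<le> 2 * m" "2 * m \<le> n + 1" "0 < m" using False n by (auto simp: m_def)
  have "ereal ((real n - real m + real m / 2) / (real m / 2)) \<le> strong_PoS GM_star n k"
    using strong_PoS_ge_limit[of m k n 1] m k by (simp add: algebra_simps)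
  moreover have "GM_star_bound n k - 4 / (real n + 1) \<le> (real n - real m + real m / 2) / (real m / 2)"
  proof -
    have "(real n - real m + real m / 2) / (real m / 2) = 2 * real n / real m - 1"
      using m by (simp add: field_simps)
    moreover have "2 * real n / ((real n + 1) / 2) \<le> 2 * real n / real m"
      using m by (intro divide_left_mono) auto
    moreover have "2 * real n / ((real n + 1) / 2) = 4 - 4 / (real n + 1)"
      by (simp add: field_simps)
    ultimately show ?thesis using False by (simp add: GM_star_bound_def)
  qed
  ultimately show ?thesis by (meson ereal_less_eq(3) order_trans)
qed

theorem theorem4p7:
  shows "(\<forall>n k. 1 \<le> n \<and> k \<le> n \<longrightarrow>
            strong_PoA GM_star n k \<le> ereal (GM_star_bound n k) \<and>
            strong_PoS GM_star n k \<le> ereal (GM_star_bound n k)) \<and>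
         (\<forall>\<epsilon>>0. \<exists>N. \<forall>n\<ge>N. \<forall>k\<le>n.
            ereal (GM_star_bound n k - \<epsilon>) \<le> strong_PoA GM_star n k \<and>
            ereal (GM_star_bound n k - \<epsilon>) \<le> strong_PoS GM_star n k)"
proof (intro conjI allI impI)
  fix n k :: nat assume "1 \<le> n \<and> k \<le> n"
  then show PoA: "strong_PoA GM_star n k \<le> ereal (GM_star_bound n k)"
    by (simp add: strong_PoA_le)
  then show "strong_PoS GM_star n k \<le> ereal (GM_star_bound n k)"
    using strong_PoS_le_PoA order_trans by blast
next
  fix \<epsilon> :: real assume "\<epsilon> > 0"
  \<comment> \<open>\<open>N\<close> makes \<open>4 / (n + 1)\<close> at most
    \<open>\<epsilon>\<close> and is independent of \<open>k\<close>, so tightness is uniform in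
    \<open>k\<close>.\<close>
  obtain N :: nat where N: "4 / \<epsilon> < real N" using reals_Archimedean2 by blast
  have "ereal (GM_star_bound n k - \<epsilon>) \<le> strong_PoS GM_star n k" if "N \<le> n" "k \<le> n" for n k
  proof -
    have n: "4 / \<epsilon> < real n" using N that by linarith
    moreover have "0 < 4 / \<epsilon>" using \<open>\<epsilon> > 0\<close> by simp
    ultimately have "1 \<le> n" by (cases n) auto
    have "4 / (real n + 1) \<le> \<epsilon>" using n \<open>\<epsilon> > 0\<close> by (simp add: field_simps)
    then have "ereal (GM_star_bound n k - \<epsilon>) \<le> ereal (GM_star_bound n k - 4 / (real n + 1))"
      by simp
    also have "\<dots> \<le> strong_PoS GM_star n k" by (rule strong_PoS_tight[OF \<open>1 \<le> n\<close> that(2)])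
    finally show ?thesis .
  qed
  then show "\<exists>N. \<forall>n\<ge>N. \<forall>k\<le>n.
      ereal (GM_star_bound n k - \<epsilon>) \<le> strong_PoA GM_star n k \<and>
      ereal (GM_star_bound n k - \<epsilon>) \<le> strong_PoS GM_star n k"
    using strong_PoS_le_PoA order_trans by blast
qed

end
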